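(* Let $R$ be a complete rank ring. Then the assignment $$E\longmapsto\{eR\mid e\in E\}$$ is a well-defined surjection from the set of all maximal nests in $R$ onto the set of all maximal flags over $R$. That is: if $E$ is a maximal nest in $R$, then $\{eR\mid e\in E\}$ is a maximal chain in $(\mathrm{L}(R),\subseteq)$, and every maximal chain in $(\mathrm{L}(R),\subseteq)$ is of this form.
   Context: A unital ring $R$ is (von Neumann) regular if for every $a\in R$ there is $b\in R$ with $aba=a$. A rank function on a regular ring $R$ is a map $\rho\colon R\to[0,1]$ with $\rho(1)=1$, $\rho(ab)\le\min\{\rho(a),\rho(b)\}$ for all $a,b\in R$, $\rho(e+f)=\rho(e)+\rho(f)$ for all idempotents $e,f\in R$ with $ef=fe=0$, and $\rho(a)>0$ for all $a\in R\setminus\{0\}$. Then $d_\rho(a,b):=\rho(a-b)$ is a metric on $R$; $\rho$ is complete if $(R,d_\rho)$ is a complete metric space. A complete rank ring is a regular ring admitting a complete rank function. $\mathrm{E}(R)$ is the set of idempotents of $R$, partially ordered by $e\le f:\Leftrightarrow ef=fe=e$. A nest in $R$ is a chain in $(\mathrm{E}(R),\le)$. $\mathrm{L}(R):=\{aR\mid a\in R\}$, ordered by inclusion; a flag over $R$ is a chain in $(\mathrm{L}(R),\subseteq)$. Maximal nests (flags) are those that are maximal with respect to inclusion among all nests (flags). *)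

theory Defs
  imports "HOL-Analysis.Abstract_Metric_Spaces"
begin

text \<open>Rings are types of class \<open>ring_1\<close>. This class requires \<open>0 \<noteq> 1\<close>, which costs nothing here:
  a rank function has \<open>\<rho> 1 = 1\<close> and \<open>\<rho> 0 = 0\<close>, so the zero ring is not a rank ring.\<close>

definition regular_ring :: "'a::ring_1 itself \<Rightarrow> bool" where
  "regular_ring _ \<longleftrightarrow> (\<forall>a::'a. \<exists>b. a * b * a = a)"

definition idempotents :: "'a::ring_1 set" where
  "idempotents = {e. e * e = e}"

definition rank_function :: "('a::ring_1 \<Rightarrow> real) \<Rightarrow> bool" where
  "rank_function \<rho> \<longleftrightarrow>
     (\<forall>a. 0 \<le> \<rho> a \<and> \<rho> a \<le> 1) \<and>
     \<rho> 1 = 1 \<and>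
     (\<forall>a b. \<rho> (a * b) \<le> min (\<rho> a) (\<rho> b)) \<and>
     (\<forall>e\<in>idempotents. \<forall>f\<in>idempotents. e * f = 0 \<and> f * e = 0 \<longrightarrow> \<rho> (e + f) = \<rho> e + \<rho> f) \<and>
     (\<forall>a. a \<noteq> 0 \<longrightarrow> \<rho> a > 0)"

definition rank_dist :: "('a::ring_1 \<Rightarrow> real) \<Rightarrow> 'a \<Rightarrow> 'a \<Rightarrow> real" where
  "rank_dist \<rho> a b = \<rho> (a - b)"

text \<open>On a regular ring, \<open>rank_dist \<rho>\<close> is a metric; hence \<open>Metric_space.mcomplete\<close> has its intended
  meaning in \<open>complete_rank_ring\<close> below.\<close>

lemma rank_function_zero:
  assumes "rank_function \<rho>"
  shows "\<rho> 0 = 0"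
proof -
  have "0 \<in> idempotents" by (simp add: idempotents_def)
  moreover have "\<forall>e\<in>idempotents. \<forall>f\<in>idempotents. e * f = 0 \<and> f * e = 0 \<longrightarrow> \<rho> (e + f) = \<rho> e + \<rho> f"
    using assms by (simp add: rank_function_def)
  ultimately have "\<rho> (0 + 0) = \<rho> 0 + \<rho> 0"
    by (metis mult_zero_left)
  then show ?thesis by simp
qed

lemma rank_function_minus_le:
  assumes "rank_function \<rho>"
  shows "\<rho> (- a) \<le> \<rho> a"
proof -
  have "\<forall>x y. \<rho> (x * y) \<le> \<rho> y"
    using assms by (simp add: rank_function_def)
  then have "\<rho> ((- 1) * a) \<le> \<rho> a" by blast
  then show ?thesis by simp
qed

lemma regular_ring_idempotentE:
  fixes a :: "'a::ring_1"
  assumes "regular_ring TYPE('a)"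
  obtains e b where "e = a * b" "e * e = e" "e * a = a"
proof -
  obtain b where "a * b * a = a"
    using assms unfolding regular_ring_def by blast
  then show thesis
    using that[of "a * b" b] by (simp add: mult.assoc[symmetric])
qed

lemma rank_function_add_le:
  fixes a b :: "'a::ring_1"
  assumes reg: "regular_ring TYPE('a)" and \<rho>: "rank_function \<rho>"
  shows "\<rho> (a + b) \<le> \<rho> a + \<rho> b"
proof -
  have left: "\<rho> (x * y) \<le> \<rho> x" and right: "\<rho> (x * y) \<le> \<rho> y" for x y
    using \<rho> unfolding rank_function_def by simp_all
  obtain e x where e: "e = a * x" "e * e = e" "e * a = a"
    using regular_ring_idempotentE[OF reg] .
  define c where "c = (1 - e) * b"
  obtain f y where f: "f = c * y" "f * f = f" "f * c = c"
    using regular_ring_idempotentE[OF reg] .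
  have "e * c = (e - e * e) * b"
    unfolding c_def by (simp add: algebra_simps)
  then have ec: "e * c = 0"
    using e(2) by simp
  have ef: "e * f = 0"
    unfolding f(1) using ec by (simp add: mult.assoc[symmetric])
  define g where "g = f * (1 - e)"
  have gf: "g * f = f"
    unfolding g_def using ef f(2) by (simp add: algebra_simps)
  have gg: "g * g = g"
  proof -
    have "g * g = (g * f) * (1 - e)" by (simp add: g_def mult.assoc)
    then show ?thesis using gf by (simp add: g_def)
  qed
  have eg: "e * g = 0"
    unfolding g_def using ef by (simp add: mult.assoc[symmetric])
  have ge: "g * e = 0"
    unfolding g_def using e(2) by (simp add: algebra_simps)
  have c: "(1 - e) * (a + b) = c"
    unfolding c_def using e(3) by (simp add: algebra_simps)
  have "g * (a + b) = f * ((1 - e) * (a + b))"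
    unfolding g_def by (simp only: mult.assoc)
  then have "g * (a + b) = c"
    using c f(3) by simp
  then have "(e + g) * (a + b) = a + b"
    unfolding c_def using e(3) by (simp add: algebra_simps)
  then have "\<rho> (a + b) \<le> \<rho> (e + g)"
    using left[of "e + g" "a + b"] by simp
  also have "\<dots> = \<rho> e + \<rho> g"
    using \<rho> e(2) gg eg ge unfolding rank_function_def idempotents_def by blast
  also have "\<dots> \<le> \<rho> a + \<rho> b"
  proof -
    have "\<rho> e \<le> \<rho> a" using left e(1) by simp
    moreover have "\<rho> g \<le> \<rho> f" using left g_def by simp
    moreover have "\<rho> f \<le> \<rho> c" using left f(1) by simp
    moreover have "\<rho> c \<le> \<rho> b" using right c_def by simp
    ultimately show ?thesis by linarith
  qed
  finally show ?thesis .
qed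

lemma Metric_space_rank_dist:
  fixes \<rho> :: "'a::ring_1 \<Rightarrow> real"
  assumes "regular_ring TYPE('a)" and \<rho>: "rank_function \<rho>"
  shows "Metric_space UNIV (rank_dist \<rho>)"
proof
  fix x y z :: 'a
  show "0 \<le> rank_dist \<rho> x y"
    using \<rho> by (simp add: rank_function_def rank_dist_def)
  show "rank_dist \<rho> x y = rank_dist \<rho> y x"
    using rank_function_minus_le[OF \<rho>, of "x - y"] rank_function_minus_le[OF \<rho>, of "y - x"]
    by (simp add: rank_dist_def)
  show "rank_dist \<rho> x y = 0 \<longleftrightarrow> x = y"
  proof
    assume "rank_dist \<rho> x y = 0"
    then have "\<not> 0 < \<rho> (x - y)" by (simp add: rank_dist_def)
    then have "x - y = 0"
      using \<rho> unfolding rank_function_def by blast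
    then show "x = y" by simp
  next
    assume "x = y"
    then show "rank_dist \<rho> x y = 0"
      by (simp add: rank_dist_def rank_function_zero[OF \<rho>])
  qed
  show "rank_dist \<rho> x z \<le> rank_dist \<rho> x y + rank_dist \<rho> y z"
    using rank_function_add_le[OF assms, of "x - y" "y - z"] by (simp add: rank_dist_def)
qed

definition complete_rank_ring :: "'a::ring_1 itself \<Rightarrow> bool" where
  "complete_rank_ring _ \<longleftrightarrow>
     regular_ring TYPE('a) \<and>
     (\<exists>\<rho>::'a \<Rightarrow> real. rank_function \<rho> \<and> Metric_space.mcomplete UNIV (rank_dist \<rho>))"

definition idem_le :: "'a::ring_1 \<Rightarrow> 'a \<Rightarrow> bool" where
  "idem_le e f \<longleftrightarrow> e * f = e \<and> f * e = e"

definition principal_right_ideal :: "'a::ring_1 \<Rightarrow> 'a set" where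
  "principal_right_ideal a = {a * r | r. True}"

definition principal_right_ideals :: "'a::ring_1 set set" where
  "principal_right_ideals = range principal_right_ideal"

text \<open>\<open>pred_on\<close> compares elements by the reflexive closure of the given relation, so passing the
  reflexive order \<open>idem_le\<close> or the strict inclusion \<open>(\<subset>)\<close> yields chains for \<open>\<le>\<close> and \<open>\<subseteq>\<close>.\<close>

definition maximal_nest :: "'a::ring_1 set \<Rightarrow> bool" where
  "maximal_nest E \<longleftrightarrow> pred_on.maxchain idempotents idem_le E"

definition maximal_flag :: "'a::ring_1 set set \<Rightarrow> bool" where
  "maximal_flag F \<longleftrightarrow> subset.maxchain principal_right_ideals F"

end

theory Submission
  imports Defs
begin

text \<open>
  Fix a complete rank function \<open>\<rho>\<close>. On a nest, \<open>\<rho>\<close> is an isometry onto a subset of \<open>[0, 1]\<close>, because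
  \<open>f - e\<close> is an idempotent of rank \<open>\<rho> f - \<rho> e\<close> whenever \<open>e \<le> f\<close>; so a metrically closed part of a
  nest has a largest and a smallest element. Let \<open>E\<close> be a maximal nest among those contained in a
  closed set \<open>A\<close> of idempotents, and let \<open>aR\<close> be comparable with all \<open>eR\<close>, \<open>e \<in> E\<close>. With \<open>e\<close> the
  largest element of \<open>E\<close> below \<open>aR\<close> and \<open>f\<close> the smallest one above, regularity yields an idempotent
  \<open>g\<close> with \<open>e \<le> g \<le> f\<close> and \<open>gR = aR\<close>, which must belong to \<open>E\<close> as soon as it belongs to \<open>A\<close>. For \<open>A\<close>
  the set of all idempotents this shows that maximal nests give maximal flags; a maximal flag \<open>F\<close> is
  reached by taking \<open>A = {e. eR \<in> F}\<close>.
\<close>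

section \<open>Maximal chains, principal right ideals and idempotents\<close>

lemma maxchain_memI:
  assumes "pred_on.maxchain A P C" "x \<in> A"
    and "\<And>y. y \<in> C \<Longrightarrow> P\<^sup>=\<^sup>= x y \<or> P\<^sup>=\<^sup>= y x"
  shows "x \<in> C"
proof (rule ccontr)
  assume "x \<notin> C"
  moreover have "pred_on.chain A P (insert x C)"
    using assms unfolding pred_on.maxchain_def pred_on.chain_def by auto
  ultimately show False
    using assms(1) unfolding pred_on.maxchain_def by blast
qed

lemma principal_right_ideal_subset_iff:
  "principal_right_ideal a \<subseteq> principal_right_ideal b \<longleftrightarrow> (\<exists>x. a = b * x)"
proof
  assume "principal_right_ideal a \<subseteq> principal_right_ideal b"
  moreover have "a * 1 \<in> principal_right_ideal a"
    unfolding principal_right_ideal_def by blast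
  ultimately show "\<exists>x. a = b * x"
    unfolding principal_right_ideal_def by auto
next
  assume "\<exists>x. a = b * x"
  then show "principal_right_ideal a \<subseteq> principal_right_ideal b"
    unfolding principal_right_ideal_def by (auto simp: mult.assoc)
qed

lemma principal_right_ideal_subset_idempotent_iff:
  assumes "e \<in> idempotents"
  shows "principal_right_ideal a \<subseteq> principal_right_ideal e \<longleftrightarrow> e * a = a"
  using assms unfolding principal_right_ideal_subset_iff idempotents_def
  by (auto simp: mult.assoc[symmetric]) metis

lemma idem_le_imp_subset:
  "idem_le e f \<Longrightarrow> principal_right_ideal e \<subseteq> principal_right_ideal f"
  unfolding idem_le_def principal_right_ideal_subset_iff by metis

lemma idem_le_refl: "e \<in> idempotents \<Longrightarrow> idem_le e e"
  by (simp add: idem_le_def idempotents_def)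

lemma idem_le_trans: "idem_le e f \<Longrightarrow> idem_le f g \<Longrightarrow> idem_le e g"
  unfolding idem_le_def by (metis mult.assoc)

text \<open>Since e lies in aR, the ideal aR is the direct sum of eR and cR, where c = a - ea
  generates the part of aR killed by left multiplication with e. An idempotent q below f - e with qR
  = cR is then orthogonal to e, and e + q is the required idempotent.\<close>

lemma idempotent_between:
  fixes a :: "'a::ring_1"
  assumes reg: "regular_ring TYPE('a)"
    and e: "e \<in> idempotents" and f: "f \<in> idempotents" and ef: "idem_le e f"
    and ea: "principal_right_ideal e \<subseteq> principal_right_ideal a"
    and af: "principal_right_ideal a \<subseteq> principal_right_ideal f"
  obtains g where "g \<in> idempotents" "idem_le e g" "idem_le g f"
    "principal_right_ideal g = principal_right_ideal a"
proof -
  have ee: "e * e = e" and ff: "f * f = f" and ef1: "e * f = e" and fe: "f * e = e"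
    using e f ef by (auto simp: idempotents_def idem_le_def)
  have fa: "f * a = a"
    using af f by (simp add: principal_right_ideal_subset_idempotent_iff)
  obtain x where x: "e = a * x"
    using ea by (auto simp: principal_right_ideal_subset_iff)
  define h where "h = f - e"
  define c where "c = a - e * a"
  have hh: "h * h = h" and eh: "e * h = 0" and he: "h * e = 0" and fh: "f * h = h" and hf: "h * f = h"
    by (simp_all add: h_def algebra_simps ee ff ef1 fe)
  have ha: "h * a = c"
    by (simp add: h_def c_def algebra_simps fa)
  obtain p y where p: "p = c * y" "p * p = p" "p * c = c"
    using regular_ring_idempotentE[OF reg] .
  have hc: "h * c = c"
    using ha hh by (metis mult.assoc)
  have hp: "h * p = p"
    by (simp add: p(1) mult.assoc[symmetric] hc)
  \<comment> \<open>The idempotent p generates cR, but p need not lie below h. Multiplying by h on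
    the right keeps the ideal, because qa = c, and gives hq = qh = q.\<close>
  define q where "q = p * h"
  have eq: "e * q = 0"
    unfolding q_def by (metis eh hp mult.assoc mult_zero_left)
  have qe: "q * e = 0"
    by (simp add: q_def mult.assoc he)
  have qq: "q * q = q"
    unfolding q_def by (metis hp mult.assoc p(2))
  have fq: "f * q = q"
    unfolding q_def by (metis fh hp mult.assoc)
  have qf: "q * f = q"
    by (simp add: q_def mult.assoc hf)
  have qa: "q * a = c"
    by (simp add: q_def mult.assoc ha p(3))
  have c: "c = a * (1 - x * a)"
    by (simp add: c_def x algebra_simps)
  have g1: "(e + q) \<in> idempotents"
    by (simp add: idempotents_def algebra_simps ee eq qe qq)
  have g2: "idem_le e (e + q)"
    by (simp add: idem_le_def algebra_simps ee eq qe)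
  have g3: "idem_le (e + q) f"
    by (simp add: idem_le_def algebra_simps ef1 fe fq qf)
  \<comment> \<open>The explicit factor puts e + q into aR. The reverse inclusion comes from (e +
    q)a = ea + c = a.\<close>
  have "e + q = a * (x + (1 - x * a) * y * h)"
    unfolding distrib_left q_def p(1) using x c by (simp add: mult.assoc[symmetric])
  moreover have "(e + q) * a = a"
    by (simp add: algebra_simps qa c_def)
  ultimately have "principal_right_ideal (e + q) = principal_right_ideal a"
    by (metis principal_right_ideal_subset_iff subset_antisym)
  then show thesis
    using that g1 g2 g3 by blast
qed

section \<open>Estimates for a fixed complete rank function\<close>

locale complete_rank =
  fixes \<rho> :: "'a::ring_1 \<Rightarrow> real"
  assumes regular: "regular_ring TYPE('a)"
    and rank: "rank_function \<rho>"
    and complete: "Metric_space.mcomplete UNIV (rank_dist \<rho>)"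
begin

lemma rank_nonneg: "0 \<le> \<rho> a"
  and rank_mult_left: "\<rho> (a * b) \<le> \<rho> a"
  and rank_mult_right: "\<rho> (a * b) \<le> \<rho> b"
  and rank_orth: "e \<in> idempotents \<Longrightarrow> f \<in> idempotents \<Longrightarrow> e * f = 0 \<Longrightarrow> f * e = 0 \<Longrightarrow> \<rho> (e + f) = \<rho> e + \<rho> f"
  using rank by (auto simp: rank_function_def)

lemma rank_eq_0_iff: "\<rho> a = 0 \<longleftrightarrow> a = 0"
  using rank rank_function_zero[OF rank] unfolding rank_function_def by (metis less_irrefl)

lemma rank_minus: "\<rho> (- a) = \<rho> a"
  using rank_function_minus_le[OF rank, of a] rank_function_minus_le[OF rank, of "- a"] by simp

lemma rank_add_le: "\<rho> (a + b) \<le> \<rho> a + \<rho> b"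
  using rank_function_add_le[OF regular rank] .

lemma rank_diff_le: "\<rho> (a - b) \<le> \<rho> a + \<rho> b"
  using rank_add_le[of a "- b"] by (simp add: rank_minus)

lemma rank_diff_commute: "\<rho> (a - b) = \<rho> (b - a)"
  using rank_minus[of "a - b"] by simp

lemma abs_rank_diff_le: "\<bar>\<rho> a - \<rho> b\<bar> \<le> \<rho> (a - b)"
  using rank_add_le[of "a - b" b] rank_add_le[of "b - a" a] rank_diff_commute[of a b] by simp

lemma rank_diff_idem_le:
  assumes "e \<in> idempotents" "f \<in> idempotents" "idem_le e f"
  shows "\<rho> (f - e) = \<rho> f - \<rho> e"
proof -
  have "\<rho> (e + (f - e)) = \<rho> e + \<rho> (f - e)"
    using assms by (intro rank_orth) (auto simp: idempotents_def idem_le_def algebra_simps)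
  then show ?thesis by simp
qed

section \<open>Limits and closed sets in the rank metric\<close>

definition rank_tendsto :: "(nat \<Rightarrow> 'a) \<Rightarrow> 'a \<Rightarrow> bool" where
  "rank_tendsto x l \<longleftrightarrow> (\<lambda>n. \<rho> (x n - l)) \<longlonglongrightarrow> 0"

definition rank_closed :: "'a set \<Rightarrow> bool" where
  "rank_closed D \<longleftrightarrow> (\<forall>x l. (\<forall>n. x n \<in> D) \<longrightarrow> rank_tendsto x l \<longrightarrow> l \<in> D)"

lemma rank_tendstoI:
  assumes "\<And>n. \<rho> (x n - l) \<le> r n" "r \<longlonglongrightarrow> 0"
  shows "rank_tendsto x l"
  unfolding rank_tendsto_def
  by (rule tendsto_sandwich[OF _ _ tendsto_const assms(2)]) (auto simp: assms(1) rank_nonneg)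

lemma rank_tendsto_const: "rank_tendsto (\<lambda>n. a) a"
  by (simp add: rank_tendsto_def rank_function_zero[OF rank])

lemma rank_tendsto_diff:
  assumes "rank_tendsto x a" "rank_tendsto y b"
  shows "rank_tendsto (\<lambda>n. x n - y n) (a - b)"
proof (rule rank_tendstoI)
  show "\<rho> (x n - y n - (a - b)) \<le> \<rho> (x n - a) + \<rho> (y n - b)" for n
    using rank_diff_le[of "x n - a" "y n - b"] by (simp add: algebra_simps)
  show "(\<lambda>n. \<rho> (x n - a) + \<rho> (y n - b)) \<longlonglongrightarrow> 0"
    using assms tendsto_add unfolding rank_tendsto_def by fastforce
qed

lemma rank_tendsto_mult:
  assumes "rank_tendsto x a" "rank_tendsto y b"
  shows "rank_tendsto (\<lambda>n. x n * y n) (a * b)"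
proof (rule rank_tendstoI)
  fix n
  have "x n * y n - a * b = (x n - a) * y n + a * (y n - b)"
    by (simp add: algebra_simps)
  then show "\<rho> (x n * y n - a * b) \<le> \<rho> (x n - a) + \<rho> (y n - b)"
    using rank_add_le[of "(x n - a) * y n" "a * (y n - b)"]
      rank_mult_left[of "x n - a" "y n"] rank_mult_right[of a "y n - b"] by simp
next
  show "(\<lambda>n. \<rho> (x n - a) + \<rho> (y n - b)) \<longlonglongrightarrow> 0"
    using assms tendsto_add unfolding rank_tendsto_def by fastforce
qed

lemma tendsto_rank:
  assumes "rank_tendsto x l"
  shows "(\<lambda>n. \<rho> (x n)) \<longlonglongrightarrow> \<rho> l"
proof -
  have "(\<lambda>n. \<rho> (x n) - \<rho> l) \<longlonglongrightarrow> 0"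
    using assms unfolding rank_tendsto_def
    by (rule Lim_null_comparison[rotated]) (simp add: abs_rank_diff_le)
  then show ?thesis
    by (rule LIM_zero_cancel)
qed

text \<open>The product of the two ranks vanishes for every n, and the rank is continuous, so the
  product of the limit ranks vanishes. Thus a disjunction whose true side varies with n passes to
  the limit without choosing a subsequence.\<close>

lemma rank_tendsto_zero_or_zero:
  assumes "rank_tendsto x a" "rank_tendsto y b" "\<And>n. x n = 0 \<or> y n = 0"
  shows "a = 0 \<or> b = 0"
proof -
  have "(\<lambda>n. \<rho> (x n) * \<rho> (y n)) \<longlonglongrightarrow> \<rho> a * \<rho> b"
    by (intro tendsto_mult tendsto_rank assms)
  moreover have "(\<lambda>n. \<rho> (x n) * \<rho> (y n)) = (\<lambda>n. 0)"
    using assms(3) by (auto simp: rank_eq_0_iff)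
  ultimately have "\<rho> a * \<rho> b = 0"
    by (simp add: LIMSEQ_const_iff)
  then show ?thesis
    by (simp add: rank_eq_0_iff)
qed

lemma rank_tendsto_eq_or_eq:
  assumes "rank_tendsto x a" "rank_tendsto y b" "rank_tendsto z c" "rank_tendsto w d"
    and "\<And>n. x n = y n \<or> z n = w n"
  shows "a = b \<or> c = d"
  using rank_tendsto_zero_or_zero[OF rank_tendsto_diff[OF assms(1,2)] rank_tendsto_diff[OF assms(3,4)]]
    assms(5) by auto

lemma rank_tendsto_unique_eq:
  assumes "rank_tendsto x a" "rank_tendsto y b" "\<And>n. x n = y n"
  shows "a = b"
  using rank_tendsto_eq_or_eq[OF assms(1,2,1,2)] assms(3) by auto

lemma rank_closed_idempotents: "rank_closed idempotents"
  unfolding rank_closed_def idempotents_def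
  using rank_tendsto_unique_eq[OF rank_tendsto_mult] by blast

text \<open>Comparability is a disjunction of two conjunctions of equations. Distributing it gives
  four clauses, each a disjunction of two equations, and each clause survives the limit by
  \<open>rank_tendsto_eq_or_eq\<close>.\<close>

lemma rank_tendsto_idem_le_or:
  assumes x: "rank_tendsto x l" and or: "\<And>n. idem_le (x n) e \<or> idem_le e (x n)"
  shows "idem_le l e \<or> idem_le e l"
proof -
  note lim = x rank_tendsto_const[of e] rank_tendsto_mult[OF x rank_tendsto_const[of e]]
    rank_tendsto_mult[OF rank_tendsto_const[of e] x]
  have "l * e = l \<or> e * l = e"
    by (rule rank_tendsto_eq_or_eq[OF lim(3,1) lim(4,2)]) (use or in \<open>auto simp: idem_le_def\<close>)
  moreover have "l * e = l \<or> l * e = e"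
    by (rule rank_tendsto_eq_or_eq[OF lim(3,1) lim(3,2)]) (use or in \<open>auto simp: idem_le_def\<close>)
  moreover have "e * l = l \<or> e * l = e"
    by (rule rank_tendsto_eq_or_eq[OF lim(4,1) lim(4,2)]) (use or in \<open>auto simp: idem_le_def\<close>)
  moreover have "e * l = l \<or> l * e = e"
    by (rule rank_tendsto_eq_or_eq[OF lim(4,1) lim(3,2)]) (use or in \<open>auto simp: idem_le_def\<close>)
  ultimately show ?thesis
    unfolding idem_le_def by blast
qed

text \<open>Between ideals generated by idempotents, inclusion is a single equation, so
  comparability is one clause to which \<open>rank_tendsto_eq_or_eq\<close> applies.\<close>

lemma rank_tendsto_subset_or:
  assumes x: "rank_tendsto x l" and idem: "\<And>n. x n \<in> idempotents" "l \<in> idempotents" "f \<in> idempotents"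
    and or: "\<And>n. principal_right_ideal (x n) \<subseteq> principal_right_ideal f \<or>
                 principal_right_ideal f \<subseteq> principal_right_ideal (x n)"
  shows "principal_right_ideal l \<subseteq> principal_right_ideal f \<or>
         principal_right_ideal f \<subseteq> principal_right_ideal l"
proof -
  have "f * l = l \<or> l * f = f"
    by (rule rank_tendsto_eq_or_eq[of "\<lambda>n. f * x n" _ x _ "\<lambda>n. x n * f" _ "\<lambda>n. f"])
      (use or idem in \<open>auto intro!: rank_tendsto_mult x rank_tendsto_const
        simp: principal_right_ideal_subset_idempotent_iff\<close>)
  then show ?thesis
    using idem by (simp add: principal_right_ideal_subset_idempotent_iff)
qed

text \<open>This is where completeness enters: it translates \<open>mcomplete\<close> into the
  language of \<open>rank_tendsto\<close>.\<close>

lemma rank_Cauchy_convergent: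
  assumes "\<And>\<epsilon>. 0 < \<epsilon> \<Longrightarrow> \<exists>N. \<forall>m\<ge>N. \<forall>n\<ge>N. \<rho> (x m - x n) < \<epsilon>"
  obtains l where "rank_tendsto x l"
proof -
  interpret M: Metric_space UNIV "rank_dist \<rho>"
    using Metric_space_rank_dist[OF regular rank] .
  have "M.MCauchy x"
    unfolding M.MCauchy_def rank_dist_def using assms by fastforce
  then obtain l where "limitin M.mtopology x l sequentially"
    using complete unfolding M.mcomplete_def by blast
  then have "rank_tendsto x l"
    unfolding M.limit_metric_sequentially rank_tendsto_def rank_dist_def LIMSEQ_iff
    by (simp add: rank_nonneg)
  then show thesis
    using that by blast
qed

section \<open>Nests as isometric copies of sets of reals\<close>

definition nest :: "'a set \<Rightarrow> bool" where
  "nest E \<longleftrightarrow> E \<subseteq> idempotents \<and> (\<forall>e\<in>E. \<forall>f\<in>E. idem_le e f \<or> idem_le f e)"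

lemma nest_rank_diff:
  assumes "nest E" "e \<in> E" "f \<in> E"
  shows "\<rho> (e - f) = \<bar>\<rho> e - \<rho> f\<bar>"
proof -
  have "\<rho> (e - f) = \<rho> e - \<rho> f \<or> \<rho> (e - f) = \<rho> f - \<rho> e"
    using assms rank_diff_idem_le[of e f] rank_diff_idem_le[of f e] rank_diff_commute[of e f]
    unfolding nest_def by (metis subsetD)
  then show ?thesis
    using rank_nonneg[of "e - f"] by linarith
qed

text \<open>If instead f is below e, then e - f has rank at most 0, so e = f. Hence the order of a
  nest can be read off from the ranks.\<close>

lemma nest_idem_leI:
  assumes "nest E" "e \<in> E" "f \<in> E" "\<rho> e \<le> \<rho> f"
  shows "idem_le e f"
proof (cases "idem_le e f")
  case False
  then have fe: "idem_le f e" and idem: "e \<in> idempotents" "f \<in> idempotents"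
    using assms unfolding nest_def by blast+
  then have "\<rho> (e - f) = 0"
    using assms(4) rank_diff_idem_le[of f e] rank_nonneg[of "e - f"] by simp
  then show ?thesis
    using fe by (simp add: rank_eq_0_iff)
qed

text \<open>A convergent sequence of ranks lifts to a sequence in D, which is Cauchy by
  \<open>nest_rank_diff\<close>. Its limit lies in D and has the limit rank.\<close>

lemma nest_closure_rank:
  assumes D: "nest D" "rank_closed D" and t: "t \<in> closure (\<rho> ` D)"
  shows "t \<in> \<rho> ` D"
proof -
  obtain r where r: "\<And>n. r n \<in> \<rho> ` D" "r \<longlonglongrightarrow> t"
    using t unfolding closure_sequential by blast
  have "\<forall>n. \<exists>x. x \<in> D \<and> \<rho> x = r n"
    using r(1) by (metis imageE)
  then obtain x where x: "\<And>n. x n \<in> D" "\<And>n. \<rho> (x n) = r n"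
    by metis
  have "Cauchy r"
    using r(2) by (simp add: LIMSEQ_imp_Cauchy)
  then have "\<exists>N. \<forall>m\<ge>N. \<forall>n\<ge>N. \<rho> (x m - x n) < \<epsilon>" if "0 < \<epsilon>" for \<epsilon>
    using that nest_rank_diff[OF D(1) x(1) x(1)] unfolding Cauchy_def dist_real_def x(2) by simp
  then obtain l where l: "rank_tendsto x l"
    using rank_Cauchy_convergent by blast
  then have "r \<longlonglongrightarrow> \<rho> l"
    using tendsto_rank[OF l] by (simp add: x(2))
  moreover have "l \<in> D"
    using D(2) l x(1) unfolding rank_closed_def by blast
  ultimately show ?thesis
    using r(2) LIMSEQ_unique by blast
qed

text \<open>The supremum and infimum of the ranks lie in the closure of the set of ranks, hence are
  attained, and \<open>nest_idem_leI\<close> turns extremal rank into extremal position.\<close>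

lemma nest_has_max_min:
  assumes D: "nest D" "rank_closed D" "D \<noteq> {}"
  obtains e f where "e \<in> D" "f \<in> D" "\<And>d. d \<in> D \<Longrightarrow> idem_le d e" "\<And>d. d \<in> D \<Longrightarrow> idem_le f d"
proof -
  have bdd: "bdd_above (\<rho> ` D)" "bdd_below (\<rho> ` D)"
    using rank by (auto simp: rank_function_def intro: bdd_aboveI2[of D \<rho> 1] bdd_belowI2[of D 0 \<rho>])
  have "Sup (\<rho> ` D) \<in> \<rho> ` D"
    using D(3) bdd by (intro nest_closure_rank[OF D(1,2)] closure_contains_Sup) auto
  then obtain e where e: "e \<in> D" "\<rho> e = Sup (\<rho> ` D)"
    by (metis imageE)
  have "Inf (\<rho> ` D) \<in> \<rho> ` D"
    using D(3) bdd by (intro nest_closure_rank[OF D(1,2)] closure_contains_Inf) auto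
  then obtain f where f: "f \<in> D" "\<rho> f = Inf (\<rho> ` D)"
    by (metis imageE)
  have "\<rho> d \<le> \<rho> e" "\<rho> f \<le> \<rho> d" if "d \<in> D" for d
    unfolding e(2) f(2) using that bdd by (blast intro: cSup_upper cInf_lower)+
  then have "idem_le d e" "idem_le f d" if "d \<in> D" for d
    using that e(1) f(1) nest_idem_leI[OF D(1)] by blast+
  then show thesis
    using that e(1) f(1) by blast
qed

section \<open>Maximal nests inside a closed set of idempotents\<close>

lemma maxchain_nest:
  assumes "A \<subseteq> idempotents" "pred_on.maxchain A idem_le E"
  shows "nest E"
proof -
  have "E \<subseteq> idempotents" and "idem_le e f \<or> idem_le f e \<or> e = f" if "e \<in> E" "f \<in> E" for e f
    using assms that unfolding pred_on.maxchain_def pred_on.chain_def by auto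
  then show ?thesis
    using assms idem_le_refl unfolding nest_def pred_on.maxchain_def pred_on.chain_def
    by (metis subset_iff subset_trans)
qed

text \<open>A limit of members of E stays in A and remains comparable with every member of E, so
  maximality puts it into E.\<close>

lemma maxchain_closed:
  assumes A: "A \<subseteq> idempotents" "rank_closed A" and E: "pred_on.maxchain A idem_le E"
  shows "rank_closed E"
  unfolding rank_closed_def
proof (intro allI impI)
  fix x l assume x: "\<forall>n. x n \<in> E" and l: "rank_tendsto x l"
  have "E \<subseteq> A"
    using E by (simp add: pred_on.maxchain_def pred_on.chain_def)
  then have "l \<in> A"
    using A(2) x l unfolding rank_closed_def by blast
  moreover have "idem_le l e \<or> idem_le e l" if "e \<in> E" for e
    using rank_tendsto_idem_le_or[OF l] x that maxchain_nest[OF A(1) E] unfolding nest_def by blast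
  ultimately show "l \<in> E"
    using maxchain_memI[OF E] by blast
qed

text \<open>The set A is kept general so that one argument serves both directions of the theorem.
  The assumption \<open>sat\<close> ensures that the idempotent inserted between the neighbours of
  aR in E is a candidate for membership in E.\<close>

lemma maxchain_represents:
  assumes A: "A \<subseteq> idempotents" "rank_closed A" "0 \<in> A" "1 \<in> A"
    and sat: "\<And>g. g \<in> idempotents \<Longrightarrow> principal_right_ideal g = principal_right_ideal a \<Longrightarrow> g \<in> A"
    and E: "pred_on.maxchain A idem_le E"
    and comp: "\<And>e. e \<in> E \<Longrightarrow> principal_right_ideal e \<subseteq> principal_right_ideal a \<or>
                             principal_right_ideal a \<subseteq> principal_right_ideal e"
  obtains e where "e \<in> E" "principal_right_ideal e = principal_right_ideal a"
proof -
  have nest: "nest E" and closed: "rank_closed E"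
    using maxchain_nest maxchain_closed A(1,2) E by blast+
  \<comment> \<open>These two elements make the lower part L and the upper part U below
    nonempty.\<close>
  have E01: "0 \<in> E" "1 \<in> E"
    using A(3,4) by (auto intro!: maxchain_memI[OF E] simp: idem_le_def)
  obtain p x where p: "p = a * x" "p * p = p" "p * a = a"
    using regular_ring_idempotentE[OF regular] .
  have pa: "principal_right_ideal p = principal_right_ideal a"
    using p by (metis principal_right_ideal_subset_iff subset_antisym)
  have pidem: "p \<in> idempotents"
    using p by (simp add: idempotents_def)
  \<comment> \<open>L and U collect the members of E whose ideals lie below and above aR. Using the
    idempotent generator p of aR turns both conditions into equations, which are preserved under
    limits.\<close>
  define L where "L = {e \<in> E. p * e = e}"
  define U where "U = {e \<in> E. e * p = p}"
  have "rank_closed L"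
    unfolding rank_closed_def
  proof (intro allI impI)
    fix y l assume y: "\<forall>n. y n \<in> L" and l: "rank_tendsto y l"
    have "p * l = l"
      by (rule rank_tendsto_unique_eq[OF rank_tendsto_mult[OF rank_tendsto_const l] l])
        (use y in \<open>auto simp: L_def\<close>)
    then show "l \<in> L"
      using closed y l unfolding rank_closed_def L_def by blast
  qed
  moreover have "nest L"
    using nest unfolding nest_def L_def by blast
  moreover have "0 \<in> L"
    using E01 by (simp add: L_def)
  ultimately obtain e where e: "e \<in> L" "\<And>d. d \<in> L \<Longrightarrow> idem_le d e"
    by (metis nest_has_max_min empty_iff)
  have "rank_closed U"
    unfolding rank_closed_def
  proof (intro allI impI)
    fix y l assume y: "\<forall>n. y n \<in> U" and l: "rank_tendsto y l"
    have "l * p = p"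
      by (rule rank_tendsto_unique_eq[OF rank_tendsto_mult[OF l rank_tendsto_const] rank_tendsto_const])
        (use y in \<open>auto simp: U_def\<close>)
    then show "l \<in> U"
      using closed y l unfolding rank_closed_def U_def by blast
  qed
  moreover have "nest U"
    using nest unfolding nest_def U_def by blast
  moreover have "1 \<in> U"
    using E01 by (simp add: U_def)
  ultimately obtain f where f: "f \<in> U" "\<And>d. d \<in> U \<Longrightarrow> idem_le f d"
    by (metis nest_has_max_min empty_iff)
  have idem: "e \<in> idempotents" "f \<in> idempotents"
    using e(1) f(1) nest by (auto simp: L_def U_def nest_def)
  have LU: "d \<in> L \<or> d \<in> U" if "d \<in> E" for d
    using comp[OF that] that nest pidem
    by (auto simp: L_def U_def nest_def principal_right_ideal_subset_idempotent_iff
        simp flip: pa)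
  have ea: "principal_right_ideal e \<subseteq> principal_right_ideal a"
    using e(1) pidem by (simp add: L_def principal_right_ideal_subset_idempotent_iff flip: pa)
  have af: "principal_right_ideal a \<subseteq> principal_right_ideal f"
    using f(1) idem by (simp add: U_def principal_right_ideal_subset_idempotent_iff flip: pa)
  have "idem_le e f \<or> idem_le f e"
    using e(1) f(1) nest unfolding nest_def L_def U_def by blast
  then show thesis
  proof
    \<comment> \<open>Here eR, aR and fR coincide, because fR is contained in eR, eR in aR, and aR
      in fR.\<close>
    assume "idem_le f e"
    then have "principal_right_ideal e = principal_right_ideal a"
      using ea af idem_le_imp_subset by blast
    then show thesis
      using that e(1) unfolding L_def by blast
  next
    assume "idem_le e f"
    then obtain g where g: "g \<in> idempotents" "idem_le e g" "idem_le g f"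
      "principal_right_ideal g = principal_right_ideal a"
      using idempotent_between[OF regular idem _ ea af] by blast
    \<comment> \<open>Each d lies in L, hence below e, or in U, hence above f, while g lies between
      e and f.\<close>
    have "idem_le g d \<or> idem_le d g" if "d \<in> E" for d
      using LU[OF that] e(2) f(2) g(2,3) idem_le_trans by blast
    then have "g \<in> E"
      using maxchain_memI[OF E] sat g(1,4) by blast
    then show thesis
      using that g(4) by blast
  qed
qed

section \<open>The correspondence between maximal nests and maximal flags\<close>

lemma principal_right_ideal_idempotent:
  fixes a :: 'a
  obtains p where "p \<in> idempotents" "principal_right_ideal p = principal_right_ideal a"
proof -
  obtain p x where p: "p = a * x" "p * p = p" "p * a = a"
    using regular_ring_idempotentE[OF regular] .
  then show thesis
    using that[of p] unfolding idempotents_def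
    by (metis (mono_tags) mem_Collect_eq principal_right_ideal_subset_iff subset_antisym)
qed

text \<open>Any ideal in a chain extending the image is comparable with all eR, so
  \<open>maxchain_represents\<close>, applied with A the set of all idempotents, shows that it
  already belongs to the image.\<close>

lemma maximal_flag_image:
  fixes E :: "'a set"
  assumes "maximal_nest E"
  shows "maximal_flag (principal_right_ideal ` E)"
proof -
  have E: "pred_on.maxchain idempotents idem_le E"
    using assms by (simp add: maximal_nest_def)
  have nest: "nest E"
    using maxchain_nest[OF _ E] by blast
  have chain: "subset.chain principal_right_ideals (principal_right_ideal ` E)"
    using nest idem_le_imp_subset unfolding nest_def subset.chain_def principal_right_ideals_def
    by blast
  have "X \<in> principal_right_ideal ` E"
    if S: "subset.chain principal_right_ideals S" "principal_right_ideal ` E \<subset> S" and "X \<in> S" for S X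
  proof -
    obtain a where a: "X = principal_right_ideal a"
      using S(1) \<open>X \<in> S\<close> unfolding subset.chain_def principal_right_ideals_def by blast
    have "principal_right_ideal e \<subseteq> X \<or> X \<subseteq> principal_right_ideal e" if "e \<in> E" for e
      using that S \<open>X \<in> S\<close> unfolding subset.chain_def by blast
    then obtain e where "e \<in> E" "principal_right_ideal e = X"
      using maxchain_represents[OF _ rank_closed_idempotents _ _ _ E, of a] a
      by (auto simp: idempotents_def)
    then show ?thesis by blast
  qed
  then show ?thesis
    using chain unfolding maximal_flag_def subset.maxchain_def by blast
qed

lemma maximal_flag_is_image:
  fixes F :: "'a set set"
  assumes "maximal_flag F"
  obtains E where "maximal_nest E" "F = principal_right_ideal ` E"
proof -
  have F: "subset.maxchain principal_right_ideals F"
    using assms by (simp add: maximal_flag_def)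
  have Fsub: "F \<subseteq> principal_right_ideals"
    and Fchain: "\<And>X Y. X \<in> F \<Longrightarrow> Y \<in> F \<Longrightarrow> X \<subseteq> Y \<or> Y \<subseteq> X"
    using F unfolding subset.maxchain_def subset.chain_def by blast+
  have memF: "principal_right_ideal a \<in> F"
    if "\<And>Y. Y \<in> F \<Longrightarrow> principal_right_ideal a \<subseteq> Y \<or> Y \<subseteq> principal_right_ideal a" for a
    by (rule maxchain_memI[OF F]) (use that in \<open>auto simp: principal_right_ideals_def\<close>)
  have F_idem: "\<exists>p\<in>idempotents. X = principal_right_ideal p" if "X \<in> F" for X
    using that Fsub principal_right_ideal_idempotent unfolding principal_right_ideals_def
    by (metis (no_types, lifting) imageE subsetD)
  \<comment> \<open>A nest maximal inside A only generates members of F. Since A contains every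
    idempotent generator of every member of F, \<open>maxchain_represents\<close> can show that none
    is missed.\<close>
  define A where "A = {e \<in> idempotents. principal_right_ideal e \<in> F}"
  have closed: "rank_closed A"
    unfolding rank_closed_def
  proof (intro allI impI)
    fix x l assume x: "\<forall>n. x n \<in> A" and l: "rank_tendsto x l"
    have xi: "x n \<in> idempotents" "principal_right_ideal (x n) \<in> F" for n
      using x by (auto simp: A_def)
    have li: "l \<in> idempotents"
      using rank_closed_idempotents l xi unfolding rank_closed_def by blast
    have "principal_right_ideal l \<subseteq> Y \<or> Y \<subseteq> principal_right_ideal l" if "Y \<in> F" for Y
    proof -
      \<comment> \<open>An idempotent generator of Y is chosen so that comparability with Y passes
        to the limit.\<close>
      obtain p where "p \<in> idempotents" "Y = principal_right_ideal p"
        using F_idem[OF \<open>Y \<in> F\<close>] by blast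
      then show ?thesis
        using rank_tendsto_subset_or[OF l xi(1) li] Fchain[OF xi(2) \<open>Y \<in> F\<close>] by blast
    qed
    then show "l \<in> A"
      using memF li by (simp add: A_def)
  qed
  \<comment> \<open>The zero ideal and the whole ring are comparable with every ideal, so maximality
    of F forces both into F.\<close>
  have "principal_right_ideal 0 \<in> F"
  proof (rule memF)
    fix Y assume "Y \<in> F"
    then obtain p where Y: "Y = principal_right_ideal p"
      using F_idem by blast
    show "principal_right_ideal 0 \<subseteq> Y \<or> Y \<subseteq> principal_right_ideal 0"
      unfolding Y principal_right_ideal_subset_iff by (metis mult_zero_right)
  qed
  moreover have "principal_right_ideal 1 \<in> F"
  proof (rule memF)
    fix Y assume "Y \<in> F"
    then obtain p where Y: "Y = principal_right_ideal p"
      using F_idem by blast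
    show "principal_right_ideal 1 \<subseteq> Y \<or> Y \<subseteq> principal_right_ideal 1"
      unfolding Y principal_right_ideal_subset_iff by (metis mult_1)
  qed
  ultimately have A01: "0 \<in> A" "1 \<in> A"
    by (simp_all add: A_def idempotents_def)
  have Asub: "A \<subseteq> idempotents"
    by (auto simp: A_def)
  obtain E where E: "pred_on.maxchain A idem_le E"
    using pred_on.Hausdorff by blast
  have nest: "nest E" and EA: "E \<subseteq> A"
    using maxchain_nest[OF Asub E] E by (auto simp: pred_on.maxchain_def pred_on.chain_def)
  have img: "F = principal_right_ideal ` E"
  proof
    show "principal_right_ideal ` E \<subseteq> F"
      using EA by (auto simp: A_def)
    show "F \<subseteq> principal_right_ideal ` E"
    proof
      fix X assume X: "X \<in> F"
      then obtain a where a: "X = principal_right_ideal a"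
        using F_idem by blast
      have "principal_right_ideal e \<subseteq> X \<or> X \<subseteq> principal_right_ideal e" if "e \<in> E" for e
        using that EA X Fchain unfolding A_def by blast
      then obtain e where "e \<in> E" "principal_right_ideal e = X"
        using maxchain_represents[OF Asub closed A01 _ E, of a] X a by (auto simp: A_def)
      then show "X \<in> principal_right_ideal ` E" by blast
    qed
  qed
  \<comment> \<open>So far E is maximal only within A. An idempotent g comparable with all of E
    generates an ideal comparable with all of F, since F is the image of E. Maximality of F then
    gives g in A, and maximality within A gives g in E.\<close>
  have "g \<in> E" if S: "pred_on.chain idempotents idem_le S" "E \<subset> S" and "g \<in> S" for S g
  proof -
    have g: "g \<in> idempotents" and comp: "\<And>e. e \<in> E \<Longrightarrow> idem_le e g \<or> idem_le g e"
      using S \<open>g \<in> S\<close> idem_le_refl unfolding pred_on.chain_def by blast+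
    have "principal_right_ideal g \<in> F"
      using comp idem_le_imp_subset by (intro memF) (auto simp: img)
    then have "g \<in> A"
      using g by (simp add: A_def)
    then show ?thesis
      using maxchain_memI[OF E] comp by blast
  qed
  moreover have "pred_on.chain idempotents idem_le E"
    using nest unfolding nest_def pred_on.chain_def by blast
  ultimately have "maximal_nest E"
    unfolding maximal_nest_def pred_on.maxchain_def by blast
  then show thesis
    using that img by blast
qed

end

theorem theorem7p18:
  assumes "complete_rank_ring TYPE('a::ring_1)"
  shows "(\<lambda>E. {principal_right_ideal e | e. e \<in> E}) ` {E :: 'a set. maximal_nest E}
           = {F :: 'a set set. maximal_flag F}"
proof -
  obtain \<rho> :: "'a \<Rightarrow> real" where "complete_rank \<rho>"
    using assms unfolding complete_rank_ring_def complete_rank_def by blast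
  then interpret complete_rank \<rho> .
  have "{principal_right_ideal e | e. e \<in> E} = principal_right_ideal ` E" for E :: "'a set"
    by blast
  then show ?thesis
    using maximal_flag_image by (auto elim: maximal_flag_is_image)
qed

end
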